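(* Let $\mathcal{Z}\subset\mathbb{R}^{d}$ be non-empty and compact and let $\mathcal{F}\subset\mathbb{R}^{d}$ be non-empty, convex and compact. Suppose that (i) $\ell$ is linear, i.e. $\ell(z,f)=z^{\mathsf T}f$; (ii) $\mathcal{F}=\{f\in\mathbb{R}^{d}\mid F(f)\le 0\}$ for some function $F:\mathbb{R}^d\to\mathbb{R}$ that is strongly convex with respect to the $L^2$ (Euclidean) norm; and (iii) $0\notin\operatorname{conv}(\mathcal{Z})$, the convex hull of $\mathcal{Z}$. Then the Follow-The-Leader strategy yields $O(\log T)$ regret: there is a constant $K>0$ (depending only on $\mathcal{Z}$ and $\mathcal{F}$) such that for every integer $T\ge2$, every sequence $z_1,\dots,z_T\in\mathcal{Z}$, and every sequence $f_1,\dots,f_T$ played by Follow-The-Leader against it, $$r_T((z_t)_{t=1,\dots,T},(f_t)_{t=1,\dots,T})\le K\log T.$$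
   Context: Regret: for $z_1,\dots,z_T\in\mathcal{Z}$ and $f_1,\dots,f_T\in\mathcal{F}$, $$r_T((z_t)_{t=1,\dots,T},(f_t)_{t=1,\dots,T})=\sum_{t=1}^T\ell(z_t,f_t)-\inf_{f\in\mathcal{F}}\sum_{t=1}^T\ell(z_t,f).$$ Follow-The-Leader (FTL): at each round $t\ge2$ the player plays some $$f_t\in\operatorname*{arg\,min}_{f\in\mathcal{F}}\frac{1}{t-1}\sum_{\tau=1}^{t-1}\ell(z_\tau,f),$$ and $f_1\in\mathcal{F}$ is arbitrary. *)

theory Defs
  imports "HOL-Analysis.Analysis"
begin

text \<open>Rounds are numbered from 1, so only the values of \<open>z\<close> and \<open>f\<close> on \<open>{1..T}\<close> matter.\<close>

definition regret ::
  "('z \<Rightarrow> 'f \<Rightarrow> real) \<Rightarrow> 'f set \<Rightarrow> nat \<Rightarrow> (nat \<Rightarrow> 'z) \<Rightarrow> (nat \<Rightarrow> 'f) \<Rightarrow> real" where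
  "regret l F T z f = (\<Sum>t=1..T. l (z t) (f t)) - (INF g\<in>F. \<Sum>t=1..T. l (z t) g)"

text \<open>A relation rather than a strategy function: the leader need not be unique, and every
  choice of minimiser is admitted.\<close>

definition follows_the_leader ::
  "('z \<Rightarrow> 'f \<Rightarrow> real) \<Rightarrow> 'f set \<Rightarrow> nat \<Rightarrow> (nat \<Rightarrow> 'z) \<Rightarrow> (nat \<Rightarrow> 'f) \<Rightarrow> bool" where
  "follows_the_leader l F T z f \<longleftrightarrow>
     f 1 \<in> F \<and>
     (\<forall>t\<in>{2..T}.
        is_arg_min (\<lambda>g. 1 / (real t - 1) * (\<Sum>\<tau>=1..t-1. l (z \<tau>) g)) (\<lambda>g. g \<in> F) (f t))"

text \<open>Strong convexity on the whole space with respect to the norm of the space, with some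
  positive modulus; no differentiability is required.\<close>

definition strongly_convex :: "('a::real_normed_vector \<Rightarrow> real) \<Rightarrow> bool" where
  "strongly_convex G \<longleftrightarrow>
     (\<exists>\<mu>>0. \<forall>x y. \<forall>u\<in>{0..1}.
        G (u *\<^sub>R x + (1 - u) *\<^sub>R y)
          \<le> u * G x + (1 - u) * G y - \<mu> / 2 * u * (1 - u) * (norm (x - y))\<^sup>2)"

end

theory Submission
  imports Defs
begin

text \<open>Strong convexity of \<open>G\<close> makes its sublevel set \<open>F\<close> strongly curved: around the midpoint of
  \<open>x, y \<in> F\<close> there is a ball of radius proportional to \<open>\<parallel>x - y\<parallel>\<^sup>2\<close> inside \<open>F\<close>. Hence a linear functional
  \<open>w\<close> grows at least like \<open>c \<parallel>w\<parallel> \<parallel>y - x\<parallel>\<^sup>2\<close> away from its minimiser \<open>x\<close> over \<open>F\<close>. Since \<open>0\<close> is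
  separated from the convex hull of \<open>Z\<close>, the cumulative loss vector after \<open>t\<close> rounds has norm at
  least \<open>\<epsilon> t\<close>, so adding one more loss vector moves the leader by only \<open>O(1/t)\<close>. By the
  be-the-leader inequality the regret is at most the sum of these moves, a harmonic sum.\<close>

lemma strongly_convex_imp_convex_on:
  fixes G :: "'a::real_normed_vector \<Rightarrow> real"
  assumes "strongly_convex G"
  shows "convex_on UNIV G"
proof (rule convex_onI)
  fix t :: real and x y :: 'a
  assume t: "0 < t" "t < 1"
  obtain \<mu> where \<mu>: "\<mu> > 0" "\<And>x y u. u \<in> {0..1} \<Longrightarrow> G (u *\<^sub>R x + (1 - u) *\<^sub>R y)
      \<le> u * G x + (1 - u) * G y - \<mu> / 2 * u * (1 - u) * (norm (x - y))\<^sup>2"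
    using assms unfolding strongly_convex_def by blast
  have "0 \<le> \<mu> / 2 * (1 - t) * (1 - (1 - t)) * (norm (x - y))\<^sup>2"
    using t \<mu>(1) by simp
  with \<mu>(2)[of "1 - t" x y] t
  show "G ((1 - t) *\<^sub>R x + t *\<^sub>R y) \<le> (1 - t) * G x + t * G y"
    by simp
qed simp

lemma quadratic_growth_on_sublevel_set:
  fixes G :: "'a::euclidean_space \<Rightarrow> real"
  assumes sc: "strongly_convex G" and bdd: "bounded {x. G x \<le> 0}"
  shows "\<exists>c>0. \<forall>w x y. G x \<le> 0 \<longrightarrow> G y \<le> 0 \<longrightarrow> (\<forall>v. G v \<le> 0 \<longrightarrow> w \<bullet> x \<le> w \<bullet> v) \<longrightarrow>
           c * norm w * (norm (y - x))\<^sup>2 \<le> w \<bullet> (y - x)"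
proof -
  have cvx: "convex_on UNIV G"
    by (rule strongly_convex_imp_convex_on[OF sc])
  obtain \<mu> where \<mu>: "\<mu> > 0" "\<And>x y u. u \<in> {0..1} \<Longrightarrow> G (u *\<^sub>R x + (1 - u) *\<^sub>R y)
      \<le> u * G x + (1 - u) * G y - \<mu> / 2 * u * (1 - u) * (norm (x - y))\<^sup>2"
    using sc unfolding strongly_convex_def by blast
  obtain B where B: "B > 0" "\<And>x. G x \<le> 0 \<Longrightarrow> norm x \<le> B"
    using bdd by (auto simp: bounded_pos)
  \<comment> \<open>The unit step \<open>m + u\<close> taken below may leave the sublevel set but
    stays in the ball of radius \<open>B + 1\<close>. A finite convex function is continuous here,
    hence bounded on this compact ball.\<close>
  have "compact (G ` cball 0 (B + 1))"
    using convex_on_continuous[OF open_UNIV cvx]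
    by (intro compact_continuous_image) (auto intro: continuous_on_subset)
  then obtain M where M: "M > 0" "\<And>x. norm x \<le> B + 1 \<Longrightarrow> G x \<le> M"
    by (auto dest!: compact_imp_bounded simp: bounded_pos abs_le_iff)
  \<comment> \<open>Points of the sublevel set are at most \<open>2 * B\<close> apart, so
    \<open>C\<close> dominates \<open>\<delta> + M\<close> for every pair \<open>x\<close>,
    \<open>y\<close>.\<close>
  define C where "C = \<mu> / 8 * (2 * B)\<^sup>2 + M"
  have C: "C > 0" using \<mu> B M by (simp add: C_def add_nonneg_pos)
  show ?thesis
  proof (intro exI[of _ "\<mu> / (4 * C)"] conjI allI impI)
    show "0 < \<mu> / (4 * C)" using \<mu> C by simp
    fix w x y
    assume x: "G x \<le> 0" and y: "G y \<le> 0" and min: "\<forall>v. G v \<le> 0 \<longrightarrow> w \<bullet> x \<le> w \<bullet> v"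
    show "\<mu> / (4 * C) * norm w * (norm (y - x))\<^sup>2 \<le> w \<bullet> (y - x)"
    proof (cases "w = 0")
      case False
      \<comment> \<open>\<open>\<delta>\<close> is the strong convexity gain at the midpoint
        \<open>m\<close>, and \<open>u\<close> is the unit direction of steepest descent of
        \<open>w\<close>. Interpolating between \<open>G m \<le> - \<delta>\<close> and
        \<open>G (m + u) \<le> M\<close> shows that a step of length \<open>s\<close> along
        \<open>u\<close> stays in the sublevel set.\<close>
      define \<delta> where "\<delta> = \<mu> / 8 * (norm (y - x))\<^sup>2"
      define s where "s = \<delta> / C"
      define m where "m = (1/2) *\<^sub>R y + (1/2) *\<^sub>R x"
      define u where "u = - (w /\<^sub>R norm w)"
      have \<delta>0: "\<delta> \<ge> 0" using \<mu> by (simp add: \<delta>_def)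
      have "norm (y - x) \<le> 2 * B"
        using norm_triangle_ineq4[of y x] B(2)[OF x] B(2)[OF y] by simp
      then have "(norm (y - x))\<^sup>2 \<le> (2 * B)\<^sup>2" by (intro power_mono) auto
      then have \<delta>C: "\<delta> + M \<le> C" using \<mu> by (simp add: \<delta>_def C_def)
      have s: "0 \<le> s" "s \<le> 1" using \<delta>0 \<delta>C C M(1) by (auto simp: s_def)
      have Gm: "G m \<le> - \<delta>"
        using \<mu>(2)[of "1/2" y x] x y by (simp add: m_def \<delta>_def)
      have "norm m \<le> B"
        using B(2) Gm \<delta>0 by simp
      moreover have "norm u = 1" using False by (simp add: u_def)
      ultimately have "norm (m + u) \<le> B + 1"
        using norm_triangle_ineq[of m u] by simp
      then have Gu: "G (m + u) \<le> M" by (rule M(2))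
      have "G ((1 - s) *\<^sub>R m + s *\<^sub>R (m + u)) \<le> (1 - s) * G m + s * G (m + u)"
        using convex_onD[OF cvx] s by simp
      also have "\<dots> \<le> (1 - s) * (- \<delta>) + s * M"
        using s Gm Gu by (intro add_mono mult_left_mono) auto
      also have "\<dots> = s * (\<delta> + M) - \<delta>" by (simp add: algebra_simps)
      also have "\<dots> \<le> s * C - \<delta>" using s \<delta>C by (simp add: mult_left_mono)
      also have "\<dots> = 0" using C by (simp add: s_def)
      finally have "G (m + s *\<^sub>R u) \<le> 0" by (simp add: algebra_simps)
      then have "w \<bullet> x \<le> w \<bullet> (m + s *\<^sub>R u)" using min by blast
      \<comment> \<open>Half of \<open>w \<bullet> (y - x)\<close> must thus pay for
        \<open>s * norm w\<close>; doubling \<open>s\<close> turns the 8 in \<open>\<delta>\<close>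
        into the 4 of the growth constant.\<close>
      also have "\<dots> = w \<bullet> x + w \<bullet> (y - x) / 2 - s * norm w"
        using False
        by (simp add: m_def u_def inner_add_right inner_diff_right dot_square_norm
            power2_eq_square field_simps)
      finally show ?thesis using C by (simp add: s_def \<delta>_def field_simps)
    qed simp
  qed
qed

text \<open>A hyperplane separating 0 from the hull gives every summand a component of at least
  \<open>b > 0\<close> along \<open>a\<close>, so the summands cannot cancel; Cauchy-Schwarz passes
  to the norm.\<close>

lemma norm_sum_ge_card_of_zero_notin_convex_hull:
  fixes Z :: "'a::euclidean_space set"
  assumes "compact Z" and "0 \<notin> convex hull Z"
  shows "\<exists>\<epsilon>>0. \<forall>(z :: 'i \<Rightarrow> 'a) I. z ` I \<subseteq> Z \<longrightarrow> \<epsilon> * real (card I) \<le> norm (\<Sum>i\<in>I. z i)"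
proof -
  obtain a b where ab: "a \<noteq> 0" "0 < b" "\<forall>x\<in>convex hull Z. a \<bullet> x > b"
    using separating_hyperplane_closed_0[of "convex hull Z"] assms
    by (auto simp: compact_imp_closed compact_convex_hull)
  show ?thesis
  proof (intro exI[of _ "b / norm a"] conjI allI impI)
    show "0 < b / norm a" using ab by simp
    fix z :: "'i \<Rightarrow> 'a" and I
    assume z: "z ` I \<subseteq> Z"
    have "b * card I \<le> (\<Sum>i\<in>I. a \<bullet> z i)"
      using sum_bounded_below[of I b "\<lambda>i. a \<bullet> z i"] ab(3) z hull_subset[of Z convex]
      by (force simp: mult.commute less_imp_le)
    also have "\<dots> \<le> norm a * norm (\<Sum>i\<in>I. z i)"
      unfolding inner_sum_right[symmetric] by (rule norm_cauchy_schwarz)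
    finally show "b / norm a * card I \<le> norm (\<Sum>i\<in>I. z i)"
      using ab(1) by (simp add: field_simps)
  qed
qed

text \<open>Induction on \<open>T\<close>: the first \<open>T\<close> rounds are compared with the
  leader after round \<open>T + 1\<close>, whose optimality then handles an arbitrary
  \<open>g\<close>. Here \<open>p (Suc t)\<close> already knows the loss of round
  \<open>t\<close>.\<close>

lemma be_the_leader:
  fixes h :: "nat \<Rightarrow> 'a \<Rightarrow> real"
  assumes "\<And>t. t \<in> {1..T} \<Longrightarrow> p (Suc t) \<in> F"
    and "\<And>t g. t \<in> {1..T} \<Longrightarrow> g \<in> F \<Longrightarrow> (\<Sum>\<tau>=1..t. h \<tau> (p (Suc t))) \<le> (\<Sum>\<tau>=1..t. h \<tau> g)"
    and "g \<in> F"
  shows "(\<Sum>t=1..T. h t (p (Suc t))) \<le> (\<Sum>t=1..T. h t g)"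
  using assms
proof (induction T arbitrary: g)
  case (Suc T)
  have "(\<Sum>t=1..T. h t (p (Suc t))) \<le> (\<Sum>t=1..T. h t (p (Suc (Suc T))))"
    using Suc.prems(1,2) by (intro Suc.IH) auto
  then have "(\<Sum>t=1..Suc T. h t (p (Suc t))) \<le> (\<Sum>t=1..Suc T. h t (p (Suc (Suc T))))"
    by simp
  also have "\<dots> \<le> (\<Sum>t=1..Suc T. h t g)"
    using Suc.prems(2)[of "Suc T" g] Suc.prems(3) by simp
  finally show ?case .
qed simp

text \<open>Each increment of the logarithm satisfies ln(n+1) - ln n \<ge> 1/(n+1), and replacing
  1/(n+1) by 1/n costs at most a factor 2.\<close>

lemma sum_inverse_pred_le_ln:
  assumes "1 \<le> n"
  shows "(\<Sum>t=2..n. 1 / (real t - 1)) \<le> 2 * ln (real n)"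
  using assms
proof (induction n rule: dec_induct)
  case (step n)
  have "ln (real n / (real n + 1)) \<le> real n / (real n + 1) - 1"
    using step by (intro ln_le_minus_one) auto
  then have "1 / (real n + 1) \<le> ln (real n + 1) - ln (real n)"
    using step by (simp add: ln_div field_simps)
  moreover have "1 / real n \<le> 2 * (1 / (real n + 1))"
    using step by (simp add: field_simps)
  ultimately show ?case using step by (simp add: add.commute)
qed simp

text \<open>The smaller weight \<open>w\<close> alone pulls the leader \<open>x\<close> back quadratically, while the change \<open>z\<close>
  of the weight pushes it only linearly.\<close>

lemma leader_stability:
  fixes w x y z :: "'a::real_inner"
  assumes growth: "c * norm w * (norm (y - x))\<^sup>2 \<le> w \<bullet> (y - x)"
    and opt: "(w + z) \<bullet> y \<le> (w + z) \<bullet> x"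
    and "0 < c" and "0 < k" and "k \<le> norm w" and "norm z \<le> R"
  shows "z \<bullet> (x - y) \<le> R\<^sup>2 / (c * k)"
proof (cases "x = y")
  case False
  define d where "d = norm (y - x)"
  have d: "d > 0" using False by (simp add: d_def)
  have R: "0 \<le> R" using \<open>norm z \<le> R\<close> norm_ge_zero[of z] by linarith
  have zd: "z \<bullet> (x - y) \<le> R * d"
    using norm_cauchy_schwarz[of z "x - y"] mult_right_mono[OF \<open>norm z \<le> R\<close>, of "norm (x - y)"]
    by (simp add: d_def norm_minus_commute)
  have "c * k * d\<^sup>2 \<le> c * norm w * d\<^sup>2"
    using assms by (intro mult_right_mono mult_left_mono) auto
  \<comment> \<open>Optimality of \<open>y\<close> for \<open>w + z\<close> bounds
    \<open>w \<bullet> (y - x)\<close> by \<open>z \<bullet> (x - y)\<close>, which is at most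
    \<open>R * d\<close>. Cancelling one \<open>d\<close> bounds the move, and inserting that bound
    into \<open>zd\<close> finishes.\<close>
  also have "\<dots> \<le> z \<bullet> (x - y)"
    using growth opt by (simp add: d_def inner_add_left inner_diff_right)
  finally have "c * k * d * d \<le> R * d" using zd by (simp add: power2_eq_square)
  then have "c * k * d \<le> R" using d by simp
  then have "d \<le> R / (c * k)" using assms by (simp add: field_simps)
  then have "R * d \<le> R * (R / (c * k))" using R by (rule mult_left_mono)
  with zd show ?thesis by (simp add: power2_eq_square)
qed (use assms in simp)

theorem theorem4:
  fixes Z F :: "(real ^ 'd) set"
    and l :: "real ^ 'd \<Rightarrow> real ^ 'd \<Rightarrow> real"
    and G :: "real ^ 'd \<Rightarrow> real"
  assumes "Z \<noteq> {}" and "compact Z"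
    and "F \<noteq> {}" and "convex F" and "compact F"
    and "\<forall>z\<in>Z. \<forall>f\<in>F. l z f = z \<bullet> f"
    and "strongly_convex G" and "F = {f. G f \<le> 0}"
    and "0 \<notin> convex hull Z"
  shows "\<exists>K>0. \<forall>T\<ge>2. \<forall>z f.
           (\<forall>t\<in>{1..T}. z t \<in> Z) \<longrightarrow> follows_the_leader l F T z f \<longrightarrow>
           regret l F T z f \<le> K * ln (real T)"
proof -
  have inF: "g \<in> F \<longleftrightarrow> G g \<le> 0" for g using \<open>F = _\<close> by simp
  have "bounded {x. G x \<le> 0}"
    using compact_imp_bounded[OF \<open>compact F\<close>] \<open>F = _\<close> by simp
  from quadratic_growth_on_sublevel_set[OF \<open>strongly_convex G\<close> this]
  obtain c where c: "c > 0"
    and "\<forall>w x y. x \<in> F \<longrightarrow> y \<in> F \<longrightarrow> (\<forall>v. v \<in> F \<longrightarrow> w \<bullet> x \<le> w \<bullet> v) \<longrightarrow>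
           c * norm w * (norm (y - x))\<^sup>2 \<le> w \<bullet> (y - x)"
    unfolding inF by (elim exE conjE)
  then have growth: "c * norm w * (norm (y - x))\<^sup>2 \<le> w \<bullet> (y - x)"
    if "x \<in> F" "y \<in> F" "\<And>v. v \<in> F \<Longrightarrow> w \<bullet> x \<le> w \<bullet> v" for w x y
    using that by simp
  from norm_sum_ge_card_of_zero_notin_convex_hull[OF \<open>compact Z\<close> \<open>0 \<notin> _\<close>]
  obtain \<epsilon> where \<epsilon>: "\<epsilon> > 0"
    and cum: "\<forall>(z :: nat \<Rightarrow> real ^ 'd) I. z ` I \<subseteq> Z \<longrightarrow> \<epsilon> * real (card I) \<le> norm (\<Sum>i\<in>I. z i)"
    by (elim exE conjE)
  obtain R where R: "R > 0" "\<And>x. x \<in> Z \<Longrightarrow> norm x \<le> R"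
    using compact_imp_bounded[OF \<open>compact Z\<close>] by (auto simp: bounded_pos)
  obtain B where B: "B > 0" "\<And>x. x \<in> F \<Longrightarrow> norm x \<le> B"
    using compact_imp_bounded[OF \<open>compact F\<close>] by (auto simp: bounded_pos)
  define A where "A = R\<^sup>2 / (c * \<epsilon>)"
  have A: "A > 0" using R c \<epsilon> by (simp add: A_def)
  show ?thesis
  proof (intro exI[of _ "4 * R * B + 2 * A"] conjI allI impI)
    show "0 < 4 * R * B + 2 * A" using R B A by (simp add: add_pos_pos)
    fix T :: nat and z f
    assume T: "2 \<le> T" and zZ: "\<forall>t\<in>{1..T}. z t \<in> Z" and ftl: "follows_the_leader l F T z f"
    define w where "w t = (\<Sum>\<tau>=1..t. z \<tau>)" for t
    have loss: "(\<Sum>\<tau>=1..t. l (z \<tau>) g) = w t \<bullet> g" if "t \<le> T" "g \<in> F" for t g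
      unfolding w_def inner_sum_left
      using that zZ \<open>\<forall>z\<in>Z. \<forall>f\<in>F. l z f = z \<bullet> f\<close> by (intro sum.cong) auto
    have f: "f t \<in> F" if "t \<in> {1..T}" for t
      using ftl that unfolding follows_the_leader_def is_arg_min_def
      by (cases "t = 1") auto
    have f_min: "w t \<bullet> f (Suc t) \<le> w t \<bullet> g" if "t \<in> {1..<T}" "g \<in> F" for t g
    proof -
      have "is_arg_min (\<lambda>g. 1 / (real (Suc t) - 1) * (\<Sum>\<tau>=1..Suc t-1. l (z \<tau>) g)) (\<lambda>g. g \<in> F)
          (f (Suc t))"
        using ftl that unfolding follows_the_leader_def by (auto dest: bspec[of _ _ "Suc t"])
      then have "(1 / real t) * (w t \<bullet> f (Suc t)) \<le> (1 / real t) * (w t \<bullet> g)"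
        using that loss[of t] f[of "Suc t"] unfolding is_arg_min_def by (auto simp: not_less)
      then show ?thesis using that by (simp add: divide_le_cancel)
    qed
    obtain q where q: "q \<in> F" "\<And>g. g \<in> F \<Longrightarrow> w T \<bullet> q \<le> w T \<bullet> g"
      using continuous_attains_inf[OF \<open>compact F\<close> \<open>F \<noteq> {}\<close>
          linear_continuous_on[OF bounded_linear_inner_right[of "w T"]]] by blast
    \<comment> \<open>The strategy fixes \<open>f\<close> only up to round \<open>T\<close>, while
      the be-the-leader inequality also needs a leader after round \<open>T\<close>;
      \<open>q\<close> supplies it.\<close>
    define p where "p = f(Suc T := q)"
    have p: "p t \<in> F" if "t \<in> {1..Suc T}" for t
      using f q that by (auto simp: p_def)
    have p_min: "w t \<bullet> p (Suc t) \<le> w t \<bullet> g" if "t \<in> {1..T}" "g \<in> F" for t g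
      using f_min[of t g] q(2)[of g] that by (cases "t = T") (auto simp: p_def)
    have "w T \<bullet> q \<le> (INF g\<in>F. \<Sum>t=1..T. l (z t) g)"
      using \<open>F \<noteq> {}\<close> q(2) loss by (intro cINF_greatest) auto
    moreover have "(\<Sum>t=1..T. z t \<bullet> p (Suc t)) \<le> (\<Sum>t=1..T. z t \<bullet> q)"
      using p p_min q(1)
      by (intro be_the_leader[of T p F "\<lambda>t g. z t \<bullet> g"]) (auto simp: w_def inner_sum_left)
    moreover have "(\<Sum>t=1..T. l (z t) (f t)) = (\<Sum>t=1..T. z t \<bullet> p t)"
      using zZ f \<open>\<forall>z\<in>Z. \<forall>f\<in>F. l z f = z \<bullet> f\<close> by (intro sum.cong) (auto simp: p_def)
    ultimately have "regret l F T z f \<le> (\<Sum>t=1..T. z t \<bullet> (p t - p (Suc t)))"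
      by (simp add: regret_def w_def inner_sum_left inner_diff_right sum_subtractf)
    \<comment> \<open>The first play is arbitrary, with no past losses to stabilise it, so round 1
      is bounded separately through the size of \<open>F\<close>.\<close>
    also have "\<dots> = z 1 \<bullet> (p 1 - p 2) + (\<Sum>t=2..T. z t \<bullet> (p t - p (Suc t)))"
      using T by (simp add: sum.atLeast_Suc_atMost numeral_2_eq_2)
    also have "z 1 \<bullet> (p 1 - p 2) \<le> R * (2 * B)"
    proof -
      have "norm (p 1 - p 2) \<le> 2 * B"
        using norm_triangle_ineq4[of "p 1" "p 2"] B(2)[OF p[of 1]] B(2)[OF p[of 2]] T by simp
      moreover have "norm (z 1) \<le> R" using R(2) zZ T by simp
      ultimately show ?thesis
        using norm_cauchy_schwarz[of "z 1" "p 1 - p 2"] R(1)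
          mult_mono[of "norm (z 1)" R "norm (p 1 - p 2)" "2 * B"] by simp
    qed
    also have "(\<Sum>t=2..T. z t \<bullet> (p t - p (Suc t))) \<le> (\<Sum>t=2..T. A * (1 / (real t - 1)))"
    proof (rule sum_mono)
      fix t assume t: "t \<in> {2..T}"
      then obtain s where s: "t = Suc s" "1 \<le> s" by (cases t) auto
      have "z t \<bullet> (p t - p (Suc t)) \<le> R\<^sup>2 / (c * (\<epsilon> * real s))"
      \<comment> \<open>The old weight is \<open>w s\<close> with \<open>s = t - 1\<close>,
        minimised by \<open>p t\<close>; adding \<open>z t\<close> gives \<open>w t\<close>,
        minimised by \<open>p (Suc t)\<close>.\<close>
      proof (rule leader_stability[where w = "w s"])
        show "c * norm (w s) * (norm (p (Suc t) - p t))\<^sup>2 \<le> w s \<bullet> (p (Suc t) - p t)"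
          using p p_min[of s] t s by (intro growth) auto
        show "(w s + z t) \<bullet> p (Suc t) \<le> (w s + z t) \<bullet> p t"
          using p_min[of t "p t"] p[of t] t s by (simp add: w_def)
        show "\<epsilon> * real s \<le> norm (w s)"
          using cum[rule_format, of z "{1..s}"] zZ t s by (auto simp: w_def image_subset_iff)
      qed (use c \<epsilon> s t zZ R(2) in auto)
      then show "z t \<bullet> (p t - p (Suc t)) \<le> A * (1 / (real t - 1))"
        using s by (simp add: A_def mult.assoc)
    qed
    also have "\<dots> \<le> A * (2 * ln (real T))"
      using sum_inverse_pred_le_ln[of T] T A
      unfolding sum_distrib_left[symmetric] by (intro mult_left_mono) auto
    finally have "regret l F T z f \<le> R * (2 * B) + A * (2 * ln (real T))" by simp
    \<comment> \<open>Since \<open>T \<ge> 2\<close>, the constant cost of round 1 is absorbed into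
      the logarithm, which doubles \<open>2 * R * B\<close> to \<open>4 * R * B\<close>.\<close>
    moreover have "1 \<le> 2 * ln (real T)"
    proof -
      have "1 \<le> 2 * ln (2::real)" using sum_inverse_pred_le_ln[of 2] by simp
      also have "\<dots> \<le> 2 * ln (real T)" using T by simp
      finally show ?thesis .
    qed
    then have "R * (2 * B) * 1 \<le> R * (2 * B) * (2 * ln (real T))"
      using R B by (intro mult_left_mono) auto
    ultimately show "regret l F T z f \<le> (4 * R * B + 2 * A) * ln (real T)"
      by (simp add: algebra_simps)
  qed
qed

end
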